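(* Let $K=\mathbb{R}$ with the trivial absolute value and let $V$ be an $n$-dimensional real vector space. Every signed seminorm $\|\cdot\|^{\mathrm{sgn}}$ on $V$ is of the form $\|\cdot\|^{\mathrm{sgn}}_{B,\vec c}$ for an ordered basis $B=(b_1,\dots,b_n)$ of $V$ and parameters $\vec c=(c_1,\dots,c_n)$ with $c_1\ge c_2\ge\dots\ge c_n$ in $\mathbb{R}_{\ge0}$.
   Context: The trivial absolute value on $\mathbb{R}$ is $|0|=0$ and $|\lambda|=1$ for $\lambda\ne0$. A signed seminorm on $V$ (over $\mathbb{R}$ with trivial absolute value) is a map $\|\cdot\|^{\mathrm{sgn}}\colon V\to\mathbb{R}$ with (i) $\|\lambda v\|^{\mathrm{sgn}}=\mathrm{sgn}(\lambda)|\lambda|\,\|v\|^{\mathrm{sgn}}=\mathrm{sgn}(\lambda)\|v\|^{\mathrm{sgn}}$ for all $\lambda\in\mathbb{R}$, $v\in V$; (ii) $\min(\|v\|^{\mathrm{sgn}},\|w\|^{\mathrm{sgn}})\le\|v+w\|^{\mathrm{sgn}}\le\max(\|v\|^{\mathrm{sgn}},\|w\|^{\mathrm{sgn}})$ for all $v,w\in V$. For an ordered basis $B=(b_1,\dots,b_n)$ of $V$ and $\vec c\in\mathbb{R}_{\ge0}^n$ with $c_1\ge\dots\ge c_n$, the signed seminorm $\|\cdot\|^{\mathrm{sgn}}_{B,\vec c}$ is defined by $$\Big\|\sum_{i=1}^n\lambda_ib_i\Big\|^{\mathrm{sgn}}_{B,\vec c}=\mathrm{sgn}(\lambda_j)\,|\lambda_j|\,c_j,\quad\text{where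 } j \text{ is the minimal index with } |\lambda_j|c_j=\max_{1\le i\le n}|\lambda_i|c_i .$$ *)

theory Defs
  imports Complex_Main
begin

definition triv_abs :: "real \<Rightarrow> real" where
  "triv_abs x = (if x = 0 then 0 else 1)"

definition signed_seminorm_on :: "'a::real_vector set \<Rightarrow> ('a \<Rightarrow> real) \<Rightarrow> bool" where
  "signed_seminorm_on V N \<longleftrightarrow>
     (\<forall>l. \<forall>v\<in>V. N (l *\<^sub>R v) = sgn l * triv_abs l * N v) \<and>
     (\<forall>v\<in>V. \<forall>w\<in>V. min (N v) (N w) \<le> N (v + w) \<and> N (v + w) \<le> max (N v) (N w))"

definition ordered_basis :: "nat \<Rightarrow> (nat \<Rightarrow> 'a::real_vector) \<Rightarrow> 'a set \<Rightarrow> bool" where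
  "ordered_basis n b V \<longleftrightarrow>
     inj_on b {1..n} \<and> independent (b ` {1..n}) \<and> span (b ` {1..n}) = V"

text \<open>The maximum is over a nonempty set only for positive \<open>n\<close>; on the zero space the only
  signed seminorm is 0, and this is the value chosen for \<open>n = 0\<close>.\<close>

definition leading_value :: "nat \<Rightarrow> (nat \<Rightarrow> real) \<Rightarrow> (nat \<Rightarrow> real) \<Rightarrow> real" where
  "leading_value n c l =
     (if n = 0 then 0
      else let j = (LEAST j. j \<in> {1..n} \<and>
                      triv_abs (l j) * c j = Max ((\<lambda>i. triv_abs (l i) * c i) ` {1..n}))
           in sgn (l j) * triv_abs (l j) * c j)"

definition basis_signed_seminorm ::
    "nat \<Rightarrow> (nat \<Rightarrow> 'a::real_vector) \<Rightarrow> (nat \<Rightarrow> real) \<Rightarrow> 'a \<Rightarrow> real" where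
  "basis_signed_seminorm n b c v = leading_value n c (\<lambda>i. representation (b ` {1..n}) v (b i))"

lemma leading_value_cong:
  assumes "\<And>i. i \<in> {1..n} \<Longrightarrow> l i = l' i"
  shows "leading_value n c l = leading_value n c l'"
proof (cases "n = 0")
  case False
  define P where "P l j \<longleftrightarrow> j \<in> {1..n} \<and>
      triv_abs (l j) * c j = Max ((\<lambda>i. triv_abs (l i) * c i) ` {1..n})" for l j
  have im: "(\<lambda>i. triv_abs (l i) * c i) ` {1..n} = (\<lambda>i. triv_abs (l' i) * c i) ` {1..n}"
    using assms by (intro image_cong) auto
  have eq: "P l = P l'"
    unfolding P_def im using assms by fastforce
  have "Max ((\<lambda>i. triv_abs (l i) * c i) ` {1..n}) \<in> (\<lambda>i. triv_abs (l i) * c i) ` {1..n}"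
    using False by (intro Max_in) auto
  then have "\<exists>j. P l j" unfolding P_def by force
  then have "P l (LEAST j. P l j)" by (rule LeastI_ex)
  then have "(LEAST j. P l j) \<in> {1..n}" by (simp add: P_def)
  then have "l (LEAST j. P l j) = l' (LEAST j. P l j)" by (rule assms)
  then show ?thesis
    using False eq unfolding leading_value_def Let_def P_def[symmetric] by simp
qed (simp add: leading_value_def)

text \<open>On a linear combination of the basis vectors, the function is given by its coefficients.\<close>

lemma basis_signed_seminorm_sum:
  assumes "ordered_basis n b V"
  shows "basis_signed_seminorm n b c (\<Sum>i=1..n. l i *\<^sub>R b i) = leading_value n c l"
proof -
  have inj: "inj_on b {1..n}" and ind: "independent (b ` {1..n})"
    using assms by (auto simp: ordered_basis_def)
  have "representation (b ` {1..n}) (\<Sum>i=1..n. l i *\<^sub>R b i) (b k) = l k" if k: "k \<in> {1..n}" for k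
  proof -
    have "representation (b ` {1..n}) (\<Sum>i=1..n. l i *\<^sub>R b i) (b k)
        = (\<Sum>i=1..n. l i * representation (b ` {1..n}) (b i) (b k))"
    proof -
      have sp: "b i \<in> span (b ` {1..n})" if "i \<in> {1..n}" for i
        using that by (intro span_base imageI)
      have "representation (b ` {1..n}) (\<Sum>i=1..n. l i *\<^sub>R b i)
          = (\<lambda>w. \<Sum>i=1..n. representation (b ` {1..n}) (l i *\<^sub>R b i) w)"
        using sp by (intro real_vector.representation_sum[OF ind] real_vector.span_scale)
      moreover have "(\<Sum>i=1..n. representation (b ` {1..n}) (l i *\<^sub>R b i) (b k))
          = (\<Sum>i=1..n. l i * representation (b ` {1..n}) (b i) (b k))"
        by (intro sum.cong refl) (simp only: real_vector.representation_scale[OF ind sp])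
      ultimately show ?thesis by simp
    qed
    also have "\<dots> = (\<Sum>i=1..n. if i = k then l i else 0)"
    proof (rule sum.cong)
      fix i assume i: "i \<in> {1..n}"
      then show "l i * representation (b ` {1..n}) (b i) (b k) = (if i = k then l i else 0)"
        using real_vector.representation_basis[OF ind, of "b i"] inj k
        by (auto simp: inj_on_eq_iff)
    qed simp
    also have "\<dots> = l k" using k by simp
    finally show ?thesis .
  qed
  then show ?thesis
    unfolding basis_signed_seminorm_def by (rule leading_value_cong)
qed

end

theory Submission
  imports Defs
begin

text \<open>
  A signed seminorm \<open>N\<close> compares vectors: put \<open>u \<le> w\<close> when \<open>0 \<le> N (w - u)\<close>. Since \<open>N\<close> is odd and
  bounded below by minima, this is a total preorder compatible with the vector space structure,
  and \<open>N\<close> itself is monotone for it (\<open>mono\<close>). The statement thus becomes a version of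
  the fact that a totally ordered finite-dimensional vector space is ordered lexicographically.

  Finite dimension supplies an order unit \<open>e\<close>, a vector some multiple of which dominates any given
  vector (\<open>order_unit\<close>). By monotonicity \<open>N e\<close> is the largest value of \<open>N\<close>. If it is
  \<open>0\<close>, then \<open>N = 0\<close> and every basis will do. Otherwise the vectors that are infinitesimal compared
  with \<open>e\<close> form a hyperplane \<open>W\<close> complementary to \<open>e\<close>: the \<open>e\<close>-coordinate of \<open>v\<close> is the infimum of
  the \<open>t\<close> with \<open>v \<le> t e\<close> (\<open>infinitesimal_decomposition\<close>). Adding an infinitesimal vector to \<open>e\<close>
  leaves \<open>N e\<close> unchanged, so \<open>e\<close> can serve as the first basis vector and induction on the dimension
  gives the others inside \<open>W\<close>. The result (\<open>exists_dominating_basis\<close>) is a basis in which each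
  \<open>b j\<close> determines \<open>N\<close> on \<open>b j + span {b i | i > j}\<close>. With \<open>c i = N (b i)\<close>, the value of \<open>N\<close> at a
  vector is then read off from its first nonzero coordinate, and so is the basis seminorm.
\<close>

section \<open>The preorder of a signed seminorm\<close>

locale signed_seminorm =
  fixes V :: "'a::real_vector set" and N :: "'a \<Rightarrow> real"
  assumes subspace: "subspace V" and seminorm: "signed_seminorm_on V N"
begin

lemmas closed = subspace_0[OF subspace] subspace_add[OF subspace] subspace_diff[OF subspace]
  subspace_scale[OF subspace] subspace_neg[OF subspace]

lemma scale: "v \<in> V \<Longrightarrow> N (l *\<^sub>R v) = sgn l * N v"
  using seminorm by (auto simp: signed_seminorm_on_def triv_abs_def)

lemma zero: "N 0 = 0"
  using scale[of 0 0] closed by simp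

lemma minus: "v \<in> V \<Longrightarrow> N (- v) = - N v"
  using scale[of v "-1"] by simp

lemma add_ge: "v \<in> V \<Longrightarrow> w \<in> V \<Longrightarrow> min (N v) (N w) \<le> N (v + w)"
  and add_le: "v \<in> V \<Longrightarrow> w \<in> V \<Longrightarrow> N (v + w) \<le> max (N v) (N w)"
  using seminorm by (auto simp: signed_seminorm_on_def)

lemma nonneg_add: "v \<in> V \<Longrightarrow> w \<in> V \<Longrightarrow> 0 \<le> N v \<Longrightarrow> 0 \<le> N w \<Longrightarrow> 0 \<le> N (v + w)"
  using add_ge[of v w] by linarith

lemma nonneg_scale: "v \<in> V \<Longrightarrow> 0 \<le> N v \<Longrightarrow> 0 \<le> t \<Longrightarrow> 0 \<le> N (t *\<^sub>R v)"
  by (simp add: scale)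

text \<open>Both inequalities for \<open>N\<close> enter: \<open>u = w + (u - w)\<close> bounds \<open>N u\<close> above by \<open>max (N w) 0\<close>,
  and \<open>w = u + (w - u)\<close> bounds \<open>N w\<close> below by \<open>min (N u) 0\<close>. The first settles the case
  \<open>0 \<le> N w\<close>, the second the case \<open>N w < 0\<close>.\<close>

lemma mono:
  assumes "u \<in> V" "w \<in> V" "0 \<le> N (w - u)"
  shows "N u \<le> N w"
proof -
  have "N (u - w) = - N (w - u)"
    using minus[of "w - u"] assms closed by simp
  moreover have "N u \<le> max (N w) (N (u - w))" "min (N u) (N (w - u)) \<le> N w"
    using add_le[of w "u - w"] add_ge[of u "w - u"] assms closed by simp_all
  ultimately show ?thesis
    using assms by linarith
qed

text \<open>The unit is the sum of the vectors of \<open>S\<close>, each replaced by its negative if \<open>N\<close> is negative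
  on it.\<close>

lemma order_unit:
  assumes "finite S" "span S \<subseteq> V"
  shows "\<exists>e\<in>span S. 0 \<le> N e \<and> (\<forall>v\<in>span S. \<exists>t\<ge>0. 0 \<le> N (t *\<^sub>R e - v))"
  using assms
proof (induction S)
  case empty
  then show ?case using zero by auto
next
  case (insert s S)
  have sub: "span S \<subseteq> span (insert s S)" by (rule span_mono) auto
  then obtain e where e: "e \<in> span S" "0 \<le> N e"
      and unit: "\<And>v. v \<in> span S \<Longrightarrow> \<exists>t\<ge>0. 0 \<le> N (t *\<^sub>R e - v)"
    using insert by blast
  define s' where "s' = (if 0 \<le> N s then s else - s)"
  have s: "s \<in> span (insert s S)" by (simp add: span_base)
  then have s': "s' \<in> span (insert s S)" by (simp add: s'_def span_neg)
  have inV: "e \<in> V" "s \<in> V" "s' \<in> V" using e s s' sub insert.prems by auto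
  then have "0 \<le> N s'" by (simp add: s'_def minus)
  have "\<exists>t\<ge>0. 0 \<le> N (t *\<^sub>R (e + s') - v)" if v: "v \<in> span (insert s S)" for v
  proof -
    obtain k where k: "v - k *\<^sub>R s \<in> span S" using v span_breakdown_eq by blast
    then obtain t where t: "0 \<le> t" "0 \<le> N (t *\<^sub>R e - (v - k *\<^sub>R s))" using unit by blast
    define a where "a = t + (\<bar>k\<bar> - (if 0 \<le> N s then k else - k))"
    have "0 \<le> a" using t by (simp add: a_def)
    have "(t + \<bar>k\<bar>) *\<^sub>R (e + s') - v
        = (t *\<^sub>R e - (v - k *\<^sub>R s)) + (\<bar>k\<bar> *\<^sub>R e + a *\<^sub>R s')"
      by (simp add: a_def s'_def algebra_simps)
    moreover have "0 \<le> N ((t *\<^sub>R e - (v - k *\<^sub>R s)) + (\<bar>k\<bar> *\<^sub>R e + a *\<^sub>R s'))"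
      using inV v k sub insert.prems t e \<open>0 \<le> a\<close> \<open>0 \<le> N s'\<close>
      by (intro nonneg_add nonneg_scale closed(2-)) auto
    ultimately have "0 \<le> N ((t + \<bar>k\<bar>) *\<^sub>R (e + s') - v)" by (simp only:)
    moreover have "0 \<le> t + \<bar>k\<bar>" using t by simp
    ultimately show ?thesis by blast
  qed
  moreover have "e + s' \<in> span (insert s S)" using e sub s' by (auto intro: span_add)
  moreover have "0 \<le> N (e + s')" using inV e \<open>0 \<le> N s'\<close> by (intro nonneg_add)
  ultimately show ?case by blast
qed

section \<open>The hyperplane of infinitesimal vectors\<close>

definition infinitesimals :: "'a \<Rightarrow> 'a set" where
  "infinitesimals e = {w\<in>V. \<forall>r>0. 0 \<le> N (r *\<^sub>R e - w) \<and> 0 \<le> N (r *\<^sub>R e + w)}"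

lemma subspace_infinitesimals:
  assumes e: "e \<in> V" "0 \<le> N e"
  shows "subspace (infinitesimals e)"
proof (rule subspaceI)
  show "0 \<in> infinitesimals e"
    using e closed by (auto simp: infinitesimals_def nonneg_scale)
next
  fix x y assume x: "x \<in> infinitesimals e" and y: "y \<in> infinitesimals e"
  then have inV: "x \<in> V" "y \<in> V" by (auto simp: infinitesimals_def)
  have "0 \<le> N (r *\<^sub>R e - (x + y)) \<and> 0 \<le> N (r *\<^sub>R e + (x + y))" if "r > 0" for r
  proof -
    have half: "r *\<^sub>R e = (r/2) *\<^sub>R e + (r/2) *\<^sub>R e"
      by (simp flip: scaleR_left_distrib)
    have "r *\<^sub>R e - (x + y) = ((r/2) *\<^sub>R e - x) + ((r/2) *\<^sub>R e - y)"
      "r *\<^sub>R e + (x + y) = ((r/2) *\<^sub>R e + x) + ((r/2) *\<^sub>R e + y)"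
      by (simp_all add: half)
    moreover have "0 \<le> N (((r/2) *\<^sub>R e - x) + ((r/2) *\<^sub>R e - y))"
      "0 \<le> N (((r/2) *\<^sub>R e + x) + ((r/2) *\<^sub>R e + y))"
      by (rule nonneg_add; use x y that inV e in \<open>auto intro!: closed simp: infinitesimals_def\<close>)+
    ultimately show ?thesis by (simp only:)
  qed
  then show "x + y \<in> infinitesimals e"
    using inV closed by (auto simp: infinitesimals_def)
next
  fix k x assume x: "x \<in> infinitesimals e"
  then have inV: "x \<in> V" by (auto simp: infinitesimals_def)
  have "0 \<le> N (r *\<^sub>R e - k *\<^sub>R x) \<and> 0 \<le> N (r *\<^sub>R e + k *\<^sub>R x)" if "r > 0" for r
  proof (cases "k = 0")
    case True
    then show ?thesis using e that by (simp add: nonneg_scale)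
  next
    case False
    then have "r / \<bar>k\<bar> > 0" using that by simp
    then have "0 \<le> N ((r / \<bar>k\<bar>) *\<^sub>R e - x)" "0 \<le> N ((r / \<bar>k\<bar>) *\<^sub>R e + x)"
      using x by (auto simp: infinitesimals_def)
    then have "0 \<le> N (\<bar>k\<bar> *\<^sub>R ((r / \<bar>k\<bar>) *\<^sub>R e - x))" "0 \<le> N (\<bar>k\<bar> *\<^sub>R ((r / \<bar>k\<bar>) *\<^sub>R e + x))"
      using inV e by (auto intro!: nonneg_scale closed)
    then show ?thesis
      using False by (cases "k > 0") (auto simp: scaleR_right_diff_distrib scaleR_right_distrib)
  qed
  then show "k *\<^sub>R x \<in> infinitesimals e"
    using inV closed by (auto simp: infinitesimals_def)
qed

text \<open>The witness is \<open>l = Inf {t. v \<le> t e}\<close>. Multiples of \<open>e\<close> slightly above \<open>l\<close> dominate \<open>v\<close> by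
  the definition of the infimum; those below \<open>l\<close> do not, so \<open>v\<close> dominates them because the
  preorder is total.\<close>

lemma infinitesimal_decomposition:
  assumes e: "e \<in> V" "0 < N e"
    and unit: "\<And>v. v \<in> V \<Longrightarrow> \<exists>t. 0 \<le> N (t *\<^sub>R e - v)"
    and v: "v \<in> V"
  shows "\<exists>l. v - l *\<^sub>R e \<in> infinitesimals e"
proof -
  define T where "T = {t. 0 \<le> N (t *\<^sub>R e - v)}"
  have "T \<noteq> {}" using unit[OF v] by (auto simp: T_def)
  obtain s where s: "0 \<le> N (s *\<^sub>R e - (- v))" using unit[of "- v"] v closed by blast
  have "- s \<le> t" if "t \<in> T" for t
  proof -
    have "0 \<le> N ((t *\<^sub>R e - v) + (s *\<^sub>R e - (- v)))"
      using that s e v by (intro nonneg_add closed) (auto simp: T_def)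
    also have "(t *\<^sub>R e - v) + (s *\<^sub>R e - (- v)) = (t + s) *\<^sub>R e"
      by (simp add: algebra_simps)
    finally have "0 \<le> sgn (t + s) * N e" using e by (simp only: scale)
    then show ?thesis using e by (simp add: zero_le_mult_iff)
  qed
  then have bdd: "bdd_below T" by (auto simp: bdd_below_def)
  define l where "l = Inf T"
  have "0 \<le> N (r *\<^sub>R e - (v - l *\<^sub>R e)) \<and> 0 \<le> N (r *\<^sub>R e + (v - l *\<^sub>R e))" if r: "r > 0" for r
  proof
    obtain t where t: "t \<in> T" "t < l + r"
      using cInf_less_iff[OF \<open>T \<noteq> {}\<close> bdd, of "l + r"] r by (auto simp: l_def)
    have "0 \<le> N ((t *\<^sub>R e - v) + (l + r - t) *\<^sub>R e)"
      using t e v by (auto intro!: nonneg_add nonneg_scale closed simp: T_def)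
    then show "0 \<le> N (r *\<^sub>R e - (v - l *\<^sub>R e))" by (simp add: algebra_simps)
    have "l - r \<notin> T" using cInf_lower[OF _ bdd, of "l - r"] r by (auto simp: l_def)
    then have "0 \<le> N (- ((l - r) *\<^sub>R e - v))"
      using e v closed by (subst minus) (auto simp: T_def)
    then show "0 \<le> N (r *\<^sub>R e + (v - l *\<^sub>R e))" by (simp add: algebra_simps)
  qed
  then show ?thesis using e v closed by (auto simp: infinitesimals_def)
qed

lemma order_unit_maximal:
  assumes "e \<in> V" "0 \<le> N e" "v \<in> V" "0 \<le> t" "0 \<le> N (t *\<^sub>R e - v)"
  shows "N v \<le> N e"
proof -
  have "N v \<le> N (t *\<^sub>R e)" using assms closed by (intro mono) auto
  also have "\<dots> \<le> N e" using assms by (auto simp: scale sgn_if)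
  finally show ?thesis .
qed

text \<open>An infinitesimal perturbation cannot bring \<open>e\<close> below half of itself, and \<open>N\<close> does not
  distinguish \<open>e\<close> from its half.\<close>

lemma infinitesimal_perturbation_ge:
  assumes "e \<in> V" "w \<in> infinitesimals e"
  shows "N e \<le> N (e + w)"
proof -
  have w: "w \<in> V" and half: "0 \<le> N ((1/2) *\<^sub>R e + w)"
    using assms(2) half_gt_zero[of "1::real"] unfolding infinitesimals_def by auto
  have "e + w - (1/2) *\<^sub>R e = (1/2) *\<^sub>R e + w"
    using scaleR_left_distrib[of "1/2" "1/2" e] by (simp add: algebra_simps)
  then have "0 \<le> N (e + w - (1/2) *\<^sub>R e)" using half by (simp only:)
  then have "N ((1/2) *\<^sub>R e) \<le> N (e + w)"
    using assms w by (intro mono closed)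
  then show ?thesis using assms by (simp add: scale)
qed

lemma unit_not_infinitesimal:
  assumes "e \<in> V" "0 < N e"
  shows "e \<notin> infinitesimals e"
proof
  assume "e \<in> infinitesimals e"
  then have "- e \<in> infinitesimals e"
    using subspace_neg[OF subspace_infinitesimals] assms by simp
  then show False
    using infinitesimal_perturbation_ge[of e "- e"] assms zero by simp
qed

end

section \<open>A basis of successively dominating vectors\<close>

lemma exists_ordered_basis:
  assumes "subspace V" "finite S" "span S = V"
  shows "\<exists>b. ordered_basis (dim V) b V"
proof -
  obtain B where B: "B \<subseteq> V" "independent B" "V \<subseteq> span B" "card B = dim V"
    using basis_exists by blast
  have "finite B" using independent_span_bound[of S B] assms B by auto
  then obtain b where "bij_betw b {1..card B} B" using ex_bij_betw_nat_finite_1 by blast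
  moreover have "span B = V" using B assms span_minimal by blast
  ultimately show ?thesis
    using B by (auto simp: ordered_basis_def bij_betw_def)
qed

text \<open>Indices start at \<open>1\<close>: the new vector takes position \<open>1\<close>, the old ones move up by one, and
  the value at \<open>0\<close> is arbitrary.\<close>

lemma ordered_basis_Cons:
  assumes b: "ordered_basis m b W" and e: "e \<notin> W"
    and V: "\<And>v. v \<in> V \<longleftrightarrow> (\<exists>l. v - l *\<^sub>R e \<in> W)"
  shows "ordered_basis (Suc m) (case_nat undefined (case_nat e (\<lambda>i. b (Suc i)))) V"
    (is "ordered_basis _ ?b _")
proof -
  have img: "?b ` {1..Suc m} = insert e (b ` {1..m})"
  proof -
    have "{1..Suc m} = insert 1 (Suc ` {1..m})" by (auto simp: image_Suc_atLeastAtMost)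
    then have "?b ` {1..Suc m} = insert e ((\<lambda>i. ?b (Suc i)) ` {1..m})"
      by (simp only: image_insert image_image) simp
    also have "(\<lambda>i. ?b (Suc i)) ` {1..m} = b ` {1..m}"
      by (intro image_cong) (auto split: nat.split)
    finally show ?thesis .
  qed
  have W: "inj_on b {1..m}" "independent (b ` {1..m})" "span (b ` {1..m}) = W"
    using b by (auto simp: ordered_basis_def)
  have new: "e \<notin> b ` {1..m}" using W e span_base by blast
  have "card (?b ` {1..Suc m}) = card {1..Suc m}"
    using new W by (simp only: img) (simp add: card_image)
  then have "inj_on ?b {1..Suc m}" by (intro eq_card_imp_inj_on) auto
  moreover have "independent (?b ` {1..Suc m})"
    using W e by (simp only: img independent_insert) auto
  moreover have "span (?b ` {1..Suc m}) = V"
    using V W by (auto simp only: img span_breakdown_eq)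
  ultimately show ?thesis by (simp add: ordered_basis_def)
qed

text \<open>In the last condition \<open>w\<close> combines the later basis vectors, so a vector whose first nonzero
  coordinate is \<open>l\<close> at index \<open>j\<close> has value \<open>sgn l * N (b j)\<close>. The values \<open>N (b j)\<close> are decreasing
  as a consequence (\<open>dominating_basis_decreasing\<close>).\<close>

definition dominating_basis :: "nat \<Rightarrow> (nat \<Rightarrow> 'a::real_vector) \<Rightarrow> 'a set \<Rightarrow> ('a \<Rightarrow> real) \<Rightarrow> bool" where
  "dominating_basis n b V N \<longleftrightarrow> ordered_basis n b V \<and> (\<forall>i\<in>{1..n}. 0 \<le> N (b i)) \<and>
     (\<forall>j\<in>{1..n}. \<forall>w\<in>span (b ` {j<..n}). N (b j + w) = N (b j))"

text \<open>The order unit \<open>e\<close> comes first, followed by a basis of the hyperplane of infinitesimals. When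
  \<open>N e = 0\<close> there is no such hyperplane, as all of \<open>V\<close> is infinitesimal, but then \<open>N\<close> vanishes.\<close>

lemma exists_dominating_basis:
  assumes "signed_seminorm V N" "finite S" "span S = V"
  shows "\<exists>b. dominating_basis (dim V) b V N"
  using assms
proof (induction "dim V" arbitrary: V S rule: less_induct)
  case less
  interpret signed_seminorm V N by fact
  obtain e where e: "e \<in> V" "0 \<le> N e"
      and unit: "\<And>v. v \<in> V \<Longrightarrow> \<exists>t\<ge>0. 0 \<le> N (t *\<^sub>R e - v)"
    using order_unit[of S] less.prems by auto
  have max: "N v \<le> N e" if "v \<in> V" for v
    using order_unit_maximal[OF e that] unit[OF that] by blast
  show ?case
  proof (cases "N e = 0")
    case True
    have null: "N v = 0" if "v \<in> V" for v
      using max[of v] max[of "- v"] that closed True by (simp add: minus)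
    obtain b where b: "ordered_basis (dim V) b V"
      using exists_ordered_basis[OF subspace less.prems(2,3)] by blast
    have bV: "b i \<in> V" if "i \<in> {1..dim V}" for i
      using b that span_base[of "b i" "b ` {1..dim V}"] by (auto simp: ordered_basis_def)
    have "span (b ` {j<..dim V}) \<subseteq> V" for j
      using bV by (intro span_minimal subspace) auto
    then show ?thesis
      using b bV null closed unfolding dominating_basis_def by (metis order_refl subsetD)
  next
    case False
    then have pos: "0 < N e" using e by simp
    define W where "W = infinitesimals e"
    have W: "subspace W" "W \<subseteq> V"
      using subspace_infinitesimals[OF e] by (auto simp: W_def infinitesimals_def)
    have eW: "e \<notin> W" using unit_not_infinitesimal e pos by (simp add: W_def)
    have V: "v \<in> V \<longleftrightarrow> (\<exists>l. v - l *\<^sub>R e \<in> W)" for v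
    proof
      show "v \<in> V \<Longrightarrow> \<exists>l. v - l *\<^sub>R e \<in> W"
        using infinitesimal_decomposition[OF e(1) pos] unit unfolding W_def by blast
      assume "\<exists>l. v - l *\<^sub>R e \<in> W"
      then obtain l where "v - l *\<^sub>R e \<in> W" by blast
      then have "(v - l *\<^sub>R e) + l *\<^sub>R e \<in> V" using W e by (intro closed(2) closed(4)) auto
      then show "v \<in> V" by simp
    qed
    obtain B where B: "B \<subseteq> W" "independent B" "W \<subseteq> span B" "card B = dim W"
      using basis_exists by blast
    have "finite B" using independent_span_bound[of S B] less.prems W B by auto
    have spanB: "span B = W" using B W span_minimal by blast
    have "dim V = Suc (dim W)"
    proof -
      have "independent (insert e B)" using B eW spanB by (simp add: independent_insert)
      moreover have "span (insert e B) = V" using V spanB by (auto simp only: span_breakdown_eq)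
      moreover have "e \<notin> B" using B eW by auto
      ultimately show ?thesis
        using dim_eq_card[of "insert e B" V] \<open>finite B\<close> B
          span_eq_iff[THEN iffD2, OF subspace] by simp
    qed
    moreover have "signed_seminorm W N"
      using W seminorm unfolding signed_seminorm_def signed_seminorm_on_def by blast
    ultimately obtain b where b: "dominating_basis (dim W) b W N"
      using less.hyps[of W B] \<open>finite B\<close> spanB by auto
    define b' where "b' = case_nat undefined (case_nat e (\<lambda>i. b (Suc i)))"
    have b'_1: "b' (Suc 0) = e" by (simp add: b'_def)
    have b'_Suc: "b' (Suc i) = b i" if "0 < i" for i
      using that by (simp add: b'_def split: nat.split)
    have "ordered_basis (Suc (dim W)) b' V"
      unfolding b'_def using b V eW
      by (intro ordered_basis_Cons[where W = W]) (auto simp: dominating_basis_def)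
    moreover have "0 \<le> N (b' i)" if i: "i \<in> {1..Suc (dim W)}" for i
    proof (cases "i = 1")
      case True
      then show ?thesis using e by (simp add: b'_1)
    next
      case False
      then obtain k where "i = Suc k" "k \<in> {1..dim W}"
        using i by (intro that[of "i - 1"]) auto
      then show ?thesis using b by (simp add: b'_Suc dominating_basis_def)
    qed
    moreover have "N (b' j + w) = N (b' j)"
      if j: "j \<in> {1..Suc (dim W)}" and w: "w \<in> span (b' ` {j<..Suc (dim W)})" for j w
    proof -
      obtain k where k: "j = Suc k" "k \<le> dim W"
        using j by (intro that[of "j - 1"]) auto
      have "{j<..Suc (dim W)} = Suc ` {k<..dim W}"
        by (simp add: k flip: atLeastSucAtMost_greaterThanAtMost)
      then have "b' ` {j<..Suc (dim W)} = (\<lambda>i. b' (Suc i)) ` {k<..dim W}"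
        by (simp add: image_image)
      also have "\<dots> = b ` {k<..dim W}" by (intro image_cong) (auto simp: b'_Suc)
      finally have w': "w \<in> span (b ` {k<..dim W})" using w by simp
      show ?thesis
      proof (cases "k = 0")
        case True
        \<comment> \<open>\<open>b' 1 = e\<close> already has the largest value, so \<open>w\<close> cannot increase it.\<close>
        have "{0<..dim W} = {1..dim W}" by auto
        then have wW: "w \<in> W" using w' b True
          by (simp add: dominating_basis_def ordered_basis_def)
        then have "e + w \<in> V" using W e by (intro closed) auto
        then have "N (e + w) = N e"
          using max infinitesimal_perturbation_ge[of e w] e wW
          by (intro antisym) (auto simp: W_def)
        then show ?thesis by (simp add: k True b'_1)
      next
        case False
        then show ?thesis using b w' k by (simp add: b'_Suc dominating_basis_def)
      qed
    qed
    ultimately show ?thesis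
      using \<open>dim V = _\<close> by (auto simp: dominating_basis_def)
  qed
qed

text \<open>For \<open>i < j\<close>, the decomposition \<open>b j = (b i + b j) - b i\<close> writes \<open>b j\<close> as a sum of two vectors
  of value at most \<open>N (b i)\<close>.\<close>

lemma dominating_basis_decreasing:
  assumes "signed_seminorm V N" and b: "dominating_basis n b V N"
    and ij: "i \<in> {1..n}" "j \<in> {1..n}" "i \<le> j"
  shows "N (b j) \<le> N (b i)"
proof (cases "i = j")
  case False
  interpret signed_seminorm V N by fact
  have V: "span (b ` {1..n}) = V" using b by (simp add: dominating_basis_def ordered_basis_def)
  have inV: "b i \<in> V" "b j \<in> V" using ij by (auto simp: V[symmetric] intro: span_base)
  have "b j \<in> span (b ` {i<..n})" using ij False by (intro span_base) auto
  then have "N (b i + b j) = N (b i)" "0 \<le> N (b i)"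
    using b ij by (auto simp: dominating_basis_def)
  moreover have "N (b j) \<le> max (N (b i + b j)) (N (- b i))"
    using add_le[of "b i + b j" "- b i"] inV closed by simp
  ultimately show ?thesis using inV by (simp add: minus)
qed simp

section \<open>Leading coordinates\<close>

text \<open>When \<open>c j = 0\<close>, the index selected by \<open>leading_value\<close> need not be \<open>j\<close>, but both sides
  vanish because the maximum is \<open>0\<close>.\<close>

lemma leading_value_first_nonzero:
  assumes nonneg: "\<And>i. i \<in> {1..n} \<Longrightarrow> 0 \<le> c i"
    and decr: "\<And>i k. i \<in> {1..n} \<Longrightarrow> k \<in> {1..n} \<Longrightarrow> i \<le> k \<Longrightarrow> c k \<le> c i"
    and j: "j \<in> {1..n}" "l j \<noteq> 0" and before: "\<And>i. i \<in> {1..<j} \<Longrightarrow> l i = 0"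
  shows "leading_value n c l = sgn (l j) * c j"
proof -
  have le: "triv_abs (l i) * c i \<le> c j" if "i \<in> {1..n}" for i
    using before[of i] decr[OF j(1) that] nonneg[OF that] nonneg[OF j(1)] that
    by (cases "i < j") (auto simp: triv_abs_def)
  have at: "triv_abs (l j) * c j = c j" using j by (simp add: triv_abs_def)
  have Max: "Max ((\<lambda>i. triv_abs (l i) * c i) ` {1..n}) = c j"
    using le j at by (intro Max_eqI) (auto intro: rev_image_eqI)
  define k where "k = (LEAST k. k \<in> {1..n} \<and> triv_abs (l k) * c k = c j)"
  have k: "triv_abs (l k) * c k = c j"
    using LeastI[of "\<lambda>k. k \<in> {1..n} \<and> triv_abs (l k) * c k = c j" j] j at
    by (simp add: k_def)
  have "leading_value n c l = sgn (l k) * (triv_abs (l k) * c k)"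
    using j unfolding leading_value_def Max Let_def k_def[symmetric] by simp
  also have "\<dots> = sgn (l k) * c j" by (simp add: k)
  also have "\<dots> = sgn (l j) * c j"
  proof (cases "c j = 0")
    case False
    have "k = j" unfolding k_def
    proof (rule Least_equality)
      show "j \<in> {1..n} \<and> triv_abs (l j) * c j = c j" using j at by simp
      show "j \<le> i" if "i \<in> {1..n} \<and> triv_abs (l i) * c i = c j" for i
        using that before[of i] False by (cases "i < j") (auto simp: triv_abs_def)
    qed
    then show ?thesis by simp
  qed simp
  finally show ?thesis .
qed

lemma leading_value_zero:
  assumes "\<And>i. i \<in> {1..n} \<Longrightarrow> l i = 0"
  shows "leading_value n c l = 0"
proof -
  have "leading_value n c l = leading_value n c (\<lambda>_. 0)"
    using assms by (rule leading_value_cong)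
  also have "\<dots> = 0" by (simp add: leading_value_def)
  finally show ?thesis .
qed

lemma dominating_basis_sum:
  assumes "signed_seminorm V N" and b: "dominating_basis n b V N"
  shows "N (\<Sum>i=1..n. l i *\<^sub>R b i) = leading_value n (\<lambda>i. N (b i)) l"
proof (cases "\<forall>i\<in>{1..n}. l i = 0")
  case True
  interpret signed_seminorm V N by fact
  show ?thesis using True leading_value_zero[of n l] zero by simp
next
  case False
  interpret signed_seminorm V N by fact
  define j where "j = (LEAST j. j \<in> {1..n} \<and> l j \<noteq> 0)"
  have j: "j \<in> {1..n} \<and> l j \<noteq> 0"
    unfolding j_def by (rule LeastI_ex) (use False in auto)
  have before: "l i = 0" if "i \<in> {1..<j}" for i
    using not_less_Least[of i "\<lambda>j. j \<in> {1..n} \<and> l j \<noteq> 0"] that j by (auto simp: j_def)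
  \<comment> \<open>Dividing by the leading coefficient puts the sum into the form \<open>l j (b j + w)\<close>.\<close>
  define w where "w = (\<Sum>i\<in>{j<..n}. (l i / l j) *\<^sub>R b i)"
  have w: "w \<in> span (b ` {j<..n})"
    unfolding w_def by (intro span_sum span_scale span_base imageI)
  have V: "span (b ` {1..n}) = V" using b by (simp add: dominating_basis_def ordered_basis_def)
  have "b j \<in> V" using j by (auto simp: V[symmetric] intro: span_base)
  moreover have "w \<in> V" using w j span_mono[of "b ` {j<..n}" "b ` {1..n}"] V by fastforce
  moreover have "(\<Sum>i=1..n. l i *\<^sub>R b i) = l j *\<^sub>R (b j + w)"
  proof -
    have "(\<Sum>i=1..n. l i *\<^sub>R b i) = (\<Sum>i\<in>insert j {j<..n}. l i *\<^sub>R b i)"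
      using j before by (intro sum.mono_neutral_right) force+
    also have "\<dots> = l j *\<^sub>R b j + (\<Sum>i\<in>{j<..n}. l i *\<^sub>R b i)" by simp
    also have "\<dots> = l j *\<^sub>R (b j + w)"
      using j by (simp add: w_def scaleR_right_distrib scaleR_right.sum)
    finally show ?thesis .
  qed
  ultimately have "N (\<Sum>i=1..n. l i *\<^sub>R b i) = sgn (l j) * N (b j + w)"
    using closed by (simp add: scale)
  also have "\<dots> = sgn (l j) * N (b j)"
    using b j w by (simp add: dominating_basis_def)
  also have "\<dots> = leading_value n (\<lambda>i. N (b i)) l"
    using leading_value_first_nonzero[of n "\<lambda>i. N (b i)" j l] j before
      dominating_basis_decreasing[OF assms] b
    by (simp add: dominating_basis_def)
  finally show ?thesis .
qed

theorem proposition7p5: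
  fixes V :: "'a::real_vector set" and n :: nat and N :: "'a \<Rightarrow> real"
  assumes "subspace V"
    and "\<exists>S. finite S \<and> span S = V"
    and "dim V = n"
    and "signed_seminorm_on V N"
  shows "\<exists>(b :: nat \<Rightarrow> 'a) (c :: nat \<Rightarrow> real).
           ordered_basis n b V \<and>
           (\<forall>i\<in>{1..n}. 0 \<le> c i) \<and>
           (\<forall>i\<in>{1..n}. \<forall>j\<in>{1..n}. i \<le> j \<longrightarrow> c j \<le> c i) \<and>
           (\<forall>v\<in>V. N v = basis_signed_seminorm n b c v)"
proof -
  have N: "signed_seminorm V N" using assms by unfold_locales
  then obtain b where b: "dominating_basis n b V N"
    using exists_dominating_basis[OF N] assms by blast
  then have basis: "ordered_basis n b V" by (simp add: dominating_basis_def)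
  have "N v = basis_signed_seminorm n b (\<lambda>i. N (b i)) v" if "v \<in> V" for v
  proof -
    have inj: "inj_on b {1..n}" and v: "v \<in> span (b ` {1..n})"
      using basis that by (auto simp: ordered_basis_def)
    then obtain u where "v = (\<Sum>x\<in>b ` {1..n}. u x *\<^sub>R x)"
      by (auto simp: span_finite)
    then have "v = (\<Sum>i=1..n. u (b i) *\<^sub>R b i)" using inj by (simp add: sum.reindex)
    then show ?thesis
      using dominating_basis_sum[OF N b] basis_signed_seminorm_sum[OF basis] by metis
  qed
  then show ?thesis
    using b basis dominating_basis_decreasing[OF N b]
    by (intro exI[of _ b] exI[of _ "\<lambda>i. N (b i)"]) (auto simp: dominating_basis_def)
qed

end
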